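(* Let $A$ be a C$^*$-algebra. Then the C$^*$-strict topology on $M(A)$ coincides with the J-strict topology on $M(A)$ obtained when $A$ is regarded as a JB$^*$-algebra.
   Context: For a C$^*$-algebra $A$, the multipliers algebra is $M(A)=\{x\in A^{**}: xA\subseteq A,\ Ax\subseteq A\}$, where $A^{**}$ is the von Neumann algebra bidual. The C$^*$-strict topology of $M(A)$ is the locally convex topology generated by the seminorms $x\mapsto\|ax\|$ and $x\mapsto\|xa\|$, $a\in A$. Every C$^*$-algebra is a JB$^*$-algebra with its norm, its involution and the Jordan product $a\circ b=\frac12(ab+ba)$; its Jordan multipliers algebra $\{x\in A^{**}: x\circ A\subseteq A\}$ is known to be the same set $M(A)$. The J-strict topology on $M(A)$ is the locally convex topology generated by the seminorms $x\mapsto\|x\circ a\|$, $a\in A$. *)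

theory Defs
  imports "HOL-Analysis.Analysis"
begin

section \<open>Complex normed spaces and C*-algebras\<close>

class complex_normed_vector = real_normed_vector +
  fixes scaleC :: "complex \<Rightarrow> 'a \<Rightarrow> 'a"  (infixr "*\<^sub>C" 75)
  assumes scaleC_add_right: "c *\<^sub>C (x + y) = c *\<^sub>C x + c *\<^sub>C y"
    and scaleC_add_left: "(c + d) *\<^sub>C x = c *\<^sub>C x + d *\<^sub>C x"
    and scaleC_scaleC: "c *\<^sub>C d *\<^sub>C x = (c * d) *\<^sub>C x"
    and scaleC_of_real: "complex_of_real r *\<^sub>C x = r *\<^sub>R x"
    and norm_scaleC: "norm (c *\<^sub>C x) = cmod c * norm x"

text \<open>No unit is assumed. The class \<^class>\<open>real_normed_algebra\<close> contributes the ring axioms and the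
  submultiplicativity of the norm.\<close>

class cstar_algebra = complex_normed_vector + real_normed_algebra + banach +
  fixes adj :: "'a \<Rightarrow> 'a"
  assumes mult_scaleC_left: "(c *\<^sub>C x) * y = c *\<^sub>C (x * y)"
    and mult_scaleC_right: "x * (c *\<^sub>C y) = c *\<^sub>C (x * y)"
    and adj_adj: "adj (adj x) = x"
    and adj_add: "adj (x + y) = adj x + adj y"
    and adj_scaleC: "adj (c *\<^sub>C x) = cnj c *\<^sub>C adj x"
    and adj_mult: "adj (x * y) = adj y * adj x"
    and cstar_identity: "norm (adj x * x) = (norm x)\<^sup>2"

section \<open>The dual of a complex normed space\<close>

text \<open>Here \<^const>\<open>bounded_linear\<close> only gives real linearity, so complex homogeneity is added.\<close>

typedef (overloaded) 'a cdual =
  "{f :: 'a::complex_normed_vector \<Rightarrow> complex.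
      bounded_linear f \<and> (\<forall>c x. f (c *\<^sub>C x) = c * f x)}"
  morphisms cdual_apply Abs_cdual
  by (rule exI[of _ "\<lambda>x. 0"]) simp

setup_lifting type_definition_cdual

lemma cdual_eqI: "(\<And>x. cdual_apply f x = cdual_apply g x) \<Longrightarrow> f = g"
  by transfer auto

lemma bounded_linear_cdual_apply: "bounded_linear (cdual_apply f)"
  by transfer auto

lemma cdual_apply_scaleC: "cdual_apply f (c *\<^sub>C x) = c * cdual_apply f x"
  by transfer auto

instantiation cdual :: (complex_normed_vector) complex_normed_vector
begin

lift_definition norm_cdual :: "'a cdual \<Rightarrow> real" is onorm .

lift_definition zero_cdual :: "'a cdual" is "\<lambda>x. 0" by simp

lift_definition plus_cdual :: "'a cdual \<Rightarrow> 'a cdual \<Rightarrow> 'a cdual" is "\<lambda>f g x. f x + g x"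
  by (auto intro: bounded_linear_add simp: distrib_left)

lift_definition minus_cdual :: "'a cdual \<Rightarrow> 'a cdual \<Rightarrow> 'a cdual" is "\<lambda>f g x. f x - g x"
  by (auto intro: bounded_linear_sub simp: right_diff_distrib)

lift_definition uminus_cdual :: "'a cdual \<Rightarrow> 'a cdual" is "\<lambda>f x. - f x"
  by (auto intro: bounded_linear_minus)

lift_definition scaleR_cdual :: "real \<Rightarrow> 'a cdual \<Rightarrow> 'a cdual" is "\<lambda>r f x. r *\<^sub>R f x"
  by (auto intro: bounded_linear_const_scaleR)

lift_definition scaleC_cdual :: "complex \<Rightarrow> 'a cdual \<Rightarrow> 'a cdual" is "\<lambda>c f x. c * f x"
  by (auto intro: bounded_linear_const_mult)

definition dist_cdual :: "'a cdual \<Rightarrow> 'a cdual \<Rightarrow> real"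
  where "dist_cdual f g = norm (f - g)"

definition
  "(uniformity :: ('a cdual \<times> 'a cdual) filter) = (INF e\<in>{0<..}. principal {(f, g). dist f g < e})"

definition open_cdual :: "'a cdual set \<Rightarrow> bool"
  where "open_cdual S = (\<forall>f\<in>S. \<forall>\<^sub>F (f', g) in uniformity. f' = f \<longrightarrow> g \<in> S)"

definition sgn_cdual :: "'a cdual \<Rightarrow> 'a cdual"
  where "sgn_cdual f = scaleR (inverse (norm f)) f"

instance
proof
  fix f g h :: "'a cdual" and c d :: complex and r s :: real
  show "f + g + h = f + (g + h)" "f + g = g + f" "0 + f = f" "- f + f = 0" "f - g = f + - g"
    "r *\<^sub>R (f + g) = r *\<^sub>R f + r *\<^sub>R g" "(r + s) *\<^sub>R f = r *\<^sub>R f + s *\<^sub>R f"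
    "r *\<^sub>R s *\<^sub>R f = (r * s) *\<^sub>R f" "1 *\<^sub>R f = f"
    "c *\<^sub>C (f + g) = c *\<^sub>C f + c *\<^sub>C g" "(c + d) *\<^sub>C f = c *\<^sub>C f + d *\<^sub>C f"
    "c *\<^sub>C d *\<^sub>C f = (c * d) *\<^sub>C f" "complex_of_real r *\<^sub>C f = r *\<^sub>R f"
    by (transfer; simp add: fun_eq_iff algebra_simps scaleR_conv_of_real)+
  show "sgn f = scaleR (inverse (norm f)) f" "dist f g = norm (f - g)"
    by (simp_all only: sgn_cdual_def dist_cdual_def)
  show "(uniformity :: ('a cdual \<times> 'a cdual) filter) =
      (INF e\<in>{0<..}. principal {(f, g). dist f g < e})"
    by (rule uniformity_cdual_def)
  show "open S \<longleftrightarrow> (\<forall>f\<in>S. \<forall>\<^sub>F (f', g) in uniformity. f' = f \<longrightarrow> g \<in> S)"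
    for S :: "'a cdual set"
    by (rule open_cdual_def)
  show "norm f = 0 \<longleftrightarrow> f = 0"
    by transfer (auto simp: onorm_eq_0)
  show "norm (r *\<^sub>R f) = \<bar>r\<bar> * norm f"
    by transfer (auto intro: onorm_scaleR)
  show "norm (f + g) \<le> norm f + norm g"
    by transfer (auto intro: onorm_triangle)
  show "norm (c *\<^sub>C f) = cmod c * norm f"
  proof transfer
    fix c :: complex and f :: "'a \<Rightarrow> complex"
    assume "bounded_linear f \<and> (\<forall>c x. f (c *\<^sub>C x) = c * f x)"
    then have f: "bounded_linear f" by simp
    have le: "onorm (\<lambda>x. c * h x) \<le> cmod c * onorm h" if "bounded_linear h"
      for c and h :: "'a \<Rightarrow> complex"
    proof (rule onorm_bound)
      show "0 \<le> cmod c * onorm h" by (simp add: onorm_pos_le that)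
      show "norm (c * h x) \<le> cmod c * onorm h * norm x" for x
        using mult_left_mono[OF onorm[OF that, of x], of "cmod c"]
        by (simp add: norm_mult mult.assoc)
    qed
    show "onorm (\<lambda>x. c * f x) = cmod c * onorm f"
    proof (cases "c = 0")
      case True
      then show ?thesis by (simp add: onorm_zero)
    next
      case False
      have "onorm (\<lambda>x. inverse c * (c * f x)) \<le> cmod (inverse c) * onorm (\<lambda>x. c * f x)"
        by (rule le) (rule bounded_linear_const_mult[OF f])
      then have "onorm f \<le> cmod (inverse c) * onorm (\<lambda>x. c * f x)"
        using False by (simp add: mult.assoc[symmetric])
      then have "cmod c * onorm f \<le> onorm (\<lambda>x. c * f x)"
        using False by (simp add: norm_divide field_simps)
      with le[OF f, of c] show ?thesis by simp
    qed
  qed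
qed

end

section \<open>The bidual of a C*-algebra\<close>

type_synonym 'a bidual = "'a cdual cdual"

lift_definition canon :: "'a::complex_normed_vector \<Rightarrow> 'a bidual" is "\<lambda>a f. cdual_apply f a"
proof
  fix a :: 'a
  show "bounded_linear (\<lambda>f. cdual_apply f a)"
  proof (rule bounded_linear_intro)
    show "cdual_apply (f + g) a = cdual_apply f a + cdual_apply g a" for f g
      by transfer simp
    show "cdual_apply (r *\<^sub>R f) a = r *\<^sub>R cdual_apply f a" for r f
      by transfer simp
    show "norm (cdual_apply f a) \<le> norm f * norm a" for f
      by transfer (simp add: onorm)
  qed
  show "\<forall>c f. cdual_apply (c *\<^sub>C f) a = c * cdual_apply f a"
    by transfer simp
qed

lemma norm_cdual_apply_le: "norm (cdual_apply f x) \<le> norm f * norm x"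
  by transfer (simp add: onorm)

lemma norm_cdual_bound:
  "0 \<le> b \<Longrightarrow> (\<And>x. norm (cdual_apply f x) \<le> b * norm x) \<Longrightarrow> norm f \<le> b"
  by transfer (rule onorm_bound)

text \<open>The von Neumann algebra product of the bidual $A^{**}$ is the Arens product, the only product
  on $A^{**}$ that extends the one of $A$ and is separately weak* continuous (the two Arens products
  agree, as C*-algebras are Arens regular). It is built in three steps:
  $(f \cdot a)(b) = f(ab)$, $(y \cdot f)(a) = y(f \cdot a)$ and $(xy)(f) = x(y \cdot f)$.\<close>

lift_definition dual_mult :: "'a::cstar_algebra cdual \<Rightarrow> 'a \<Rightarrow> 'a cdual"
  is "\<lambda>f a b. f (a * b)"
  by (auto simp: mult_scaleC_right intro: bounded_linear_compose[OF _ bounded_linear_mult_right])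

lemma dual_mult_apply: "cdual_apply (dual_mult f a) b = cdual_apply f (a * b)"
  by transfer simp

lemma norm_dual_mult: "norm (dual_mult f a) \<le> norm f * norm a"
proof (rule norm_cdual_bound)
  fix b
  have "norm (cdual_apply f (a * b)) \<le> norm f * norm (a * b)"
    by (rule norm_cdual_apply_le)
  also have "\<dots> \<le> norm f * (norm a * norm b)"
    by (intro mult_left_mono norm_mult_ineq) simp
  finally show "norm (cdual_apply (dual_mult f a) b) \<le> norm f * norm a * norm b"
    by (simp add: dual_mult_apply mult.assoc)
qed simp

lemma cdual_apply_linear:
  "cdual_apply f (x + y) = cdual_apply f x + cdual_apply f y"
  "cdual_apply f (r *\<^sub>R x) = r *\<^sub>R cdual_apply f x"
  using bounded_linear_cdual_apply[of f]
  by (simp_all add: bounded_linear.linear linear_add linear_scale)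

lemma dual_mult_linear:
  "dual_mult f (a + b) = dual_mult f a + dual_mult f b"
  "dual_mult f (r *\<^sub>R a) = r *\<^sub>R dual_mult f a"
  "dual_mult f (c *\<^sub>C a) = c *\<^sub>C dual_mult f a"
  "dual_mult (f + g) a = dual_mult f a + dual_mult g a"
  "dual_mult (r *\<^sub>R f) a = r *\<^sub>R dual_mult f a"
  "dual_mult (c *\<^sub>C f) a = c *\<^sub>C dual_mult f a"
  by (rule cdual_eqI, simp add: dual_mult_apply plus_cdual.rep_eq scaleR_cdual.rep_eq
      scaleC_cdual.rep_eq distrib_right mult_scaleC_left cdual_apply_linear cdual_apply_scaleC)+

lift_definition bidual_act :: "'a::cstar_algebra bidual \<Rightarrow> 'a cdual \<Rightarrow> 'a cdual"
  is "\<lambda>y f a. y (dual_mult f a)"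
proof
  fix y :: "'a cdual \<Rightarrow> complex" and f :: "'a cdual"
  assume y: "bounded_linear y \<and> (\<forall>c x. y (c *\<^sub>C x) = c * y x)"
  have "bounded_linear (dual_mult f)"
    by (rule bounded_linear_intro[of _ "norm f"])
      (simp_all add: dual_mult_linear norm_dual_mult mult.commute[of _ "norm f"])
  with y show "bounded_linear (\<lambda>a. y (dual_mult f a))"
    by (blast intro: bounded_linear_compose)
  show "\<forall>c a. y (dual_mult f (c *\<^sub>C a)) = c * y (dual_mult f a)"
    using y by (simp add: dual_mult_linear)
qed

lemma bidual_act_apply: "cdual_apply (bidual_act y f) a = cdual_apply y (dual_mult f a)"
  by transfer simp

lemma norm_bidual_act: "norm (bidual_act y f) \<le> norm y * norm f"
proof (rule norm_cdual_bound)
  fix a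
  have "norm (cdual_apply y (dual_mult f a)) \<le> norm y * norm (dual_mult f a)"
    by (rule norm_cdual_apply_le)
  also have "\<dots> \<le> norm y * (norm f * norm a)"
    by (intro mult_left_mono norm_dual_mult) simp
  finally show "norm (cdual_apply (bidual_act y f) a) \<le> norm y * norm f * norm a"
    by (simp add: bidual_act_apply mult.assoc)
qed simp

lemma bidual_act_linear:
  "bidual_act y (f + g) = bidual_act y f + bidual_act y g"
  "bidual_act y (r *\<^sub>R f) = r *\<^sub>R bidual_act y f"
  "bidual_act y (c *\<^sub>C f) = c *\<^sub>C bidual_act y f"
  by (rule cdual_eqI, simp add: bidual_act_apply dual_mult_linear cdual_apply_linear
      cdual_apply_scaleC plus_cdual.rep_eq scaleR_cdual.rep_eq scaleC_cdual.rep_eq)+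

lift_definition bidual_mult :: "'a::cstar_algebra bidual \<Rightarrow> 'a bidual \<Rightarrow> 'a bidual"
    (infixl "\<bullet>\<^sub>B" 70)
  is "\<lambda>x y f. x (bidual_act y f)"
proof
  fix x :: "'a cdual \<Rightarrow> complex" and y :: "'a bidual"
  assume x: "bounded_linear x \<and> (\<forall>c f. x (c *\<^sub>C f) = c * x f)"
  have "bounded_linear (bidual_act y)"
    by (rule bounded_linear_intro[of _ "norm y"])
      (simp_all add: bidual_act_linear norm_bidual_act mult.commute[of _ "norm y"])
  with x show "bounded_linear (\<lambda>f. x (bidual_act y f))"
    by (blast intro: bounded_linear_compose)
  show "\<forall>c f. x (bidual_act y (c *\<^sub>C f)) = c * x (bidual_act y f)"
    using x by (simp add: bidual_act_linear)
qed

lemma bidual_mult_apply: "cdual_apply (x \<bullet>\<^sub>B y) f = cdual_apply x (bidual_act y f)"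
  by transfer simp

lemma canon_mult: "canon (a * b) = canon a \<bullet>\<^sub>B canon b"
  by (rule cdual_eqI)
    (simp add: bidual_mult_apply canon.rep_eq bidual_act_apply dual_mult_apply)

definition bidual_jordan :: "'a::cstar_algebra bidual \<Rightarrow> 'a bidual \<Rightarrow> 'a bidual"
    (infixl "\<circ>\<^sub>J" 70)
  where "x \<circ>\<^sub>J y = (1/2) *\<^sub>R (x \<bullet>\<^sub>B y + y \<bullet>\<^sub>B x)"

section \<open>Multipliers and strict topologies\<close>

definition multipliers :: "'a::cstar_algebra bidual set"
  where "multipliers =
    {x. (\<forall>a. x \<bullet>\<^sub>B canon a \<in> range canon) \<and> (\<forall>a. canon a \<bullet>\<^sub>B x \<in> range canon)}"

text \<open>The locally convex topology on a linear subspace \<open>M\<close> generated by a nonempty family \<open>P\<close> of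
  seminorms: the open seminorm balls are a subbase. (For \<open>P\<close> empty the carrier would be empty.)\<close>

definition seminorm_topology :: "'b::real_vector set \<Rightarrow> ('b \<Rightarrow> real) set \<Rightarrow> 'b topology"
  where "seminorm_topology M P =
    topology_generated_by {{y \<in> M. p (y - x) < e} | p x e. p \<in> P \<and> x \<in> M \<and> 0 < e}"

lemma topspace_seminorm_topology:
  assumes "P \<noteq> {}" and "\<And>p. p \<in> P \<Longrightarrow> p 0 = 0"
  shows "topspace (seminorm_topology M P) = M"
proof -
  from assms obtain p where p: "p \<in> P" "p 0 = 0" by blast
  have "x \<in> topspace (seminorm_topology M P)" if "x \<in> M" for x
  proof -
    have "x \<in> {y \<in> M. p (y - x) < 1}" using that p by simp
    moreover have "{y \<in> M. p (y - x) < 1} \<in>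
        {{y \<in> M. p (y - x) < e} | p x e. p \<in> P \<and> x \<in> M \<and> 0 < e}"
      using that p zero_less_one by blast
    ultimately show ?thesis
      unfolding seminorm_topology_def topology_generated_by_topspace by blast
  qed
  moreover have "topspace (seminorm_topology M P) \<subseteq> M"
    unfolding seminorm_topology_def topology_generated_by_topspace by auto
  ultimately show ?thesis by blast
qed

definition cstar_strict_topology :: "'a::cstar_algebra bidual topology"
  where "cstar_strict_topology = seminorm_topology multipliers
    (range (\<lambda>a x. norm (canon a \<bullet>\<^sub>B x)) \<union> range (\<lambda>a x. norm (x \<bullet>\<^sub>B canon a)))"

definition j_strict_topology :: "'a::cstar_algebra bidual topology"
  where "j_strict_topology = seminorm_topology multipliers
    (range (\<lambda>a x. norm (x \<circ>\<^sub>J canon a)))"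

end

theory Submission
  imports Defs
begin

text \<open>The Jordan seminorms are visibly bounded by the two one-sided ones; the content is the converse.
It rests on two facts.

First, multiplication by a cube is controlled by Jordan products. The sandwich $uxu$ is a
combination of $u(xu + ux)$, $(xu + ux)u$ and $xu^2 + u^2x$, hence small when $x \circ u$ and
$x \circ u^2$ are, and $u^3 x = u(u^2 x + x u^2) - (uxu)u$ trades the wrong-sided term for a
sandwich (\<open>norm_cube_mult_le\<close>).

Secondly, every element of $A$ is a complex linear combination of two cubes of elements of $A$,
because every self-adjoint $a$ of norm at most $1/2$ has a cube root in $A$
(\<open>small_self_adjoint_is_cube\<close>). Finitely many Jordan seminorms therefore dominate $\|ax\|$ and $\|xa\|$.

The cube root is $b = a (a^2)^{-1/3} = \sum_k c_k (1 - a^2)^k a$, where $\sum_k c_k t^k$ is the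
binomial series of $(1-t)^{-1/3}$ and $c_k \le (k+1)^{-2/3}$. Absolute convergence needs a decay rate
for $\|(1-a^2)^k a\|$, and $(k+1)^{-1/2}$ is enough. It comes from unitaries:
with $w = \sqrt{1-a^2}$ the formal elements $w \pm ia$ are unitary, so left multiplication by them
gives mutually inverse linear isometries $U$, $V$ of $A$ (they are defined by $1 - w$, which
lies in $A$ as the fixed point of a contraction). Now $2ia = U - V$ and
$4(1-a^2) = (U+V)^2$, and with $S = U^2$ the norm of $(U+V)^{2k}(U-V)$ is that of $(1+S)^{2k}(S-1)$.
Its coefficients are differences of neighbouring binomial coefficients, whose total variation is
$2\binom{2k}{k}$; and $4^{-k}\binom{2k}{k}$ is the $k$-th coefficient of $(1-t)^{-1/2}$.\<close>


section \<open>Comparing topologies generated by seminorms\<close>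

definition dominated_by :: "('b::real_vector \<Rightarrow> real) set \<Rightarrow> ('b \<Rightarrow> real) \<Rightarrow> bool"
  where "dominated_by Q p \<longleftrightarrow>
    (\<exists>F B. finite F \<and> F \<subseteq> Q \<and> 0 \<le> B \<and> (\<forall>x. p x \<le> B * (\<Sum>q\<in>F. q x)))"

lemma dominated_by_member: "q \<in> Q \<Longrightarrow> dominated_by Q q"
  unfolding dominated_by_def by (rule exI[of _ "{q}"], rule exI[of _ 1]) simp

lemma dominated_by_mono:
  assumes "dominated_by Q p" and "\<And>x. p' x \<le> p x"
  shows "dominated_by Q p'"
  using assms unfolding dominated_by_def by (meson order_trans)

lemma dominated_by_cmult:
  assumes "dominated_by Q p" and "0 \<le> (c::real)"
  shows "dominated_by Q (\<lambda>x. c * p x)"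
proof -
  from assms(1) obtain F B where F: "finite F" "F \<subseteq> Q" "0 \<le> B" "\<And>x. p x \<le> B * (\<Sum>q\<in>F. q x)"
    unfolding dominated_by_def by blast
  have "c * p x \<le> (c * B) * (\<Sum>q\<in>F. q x)" for x
    using mult_left_mono[OF F(4)[of x] assms(2)] by (simp add: mult.assoc)
  with F assms(2) show ?thesis
    unfolding dominated_by_def by (meson mult_nonneg_nonneg)
qed

lemma dominated_by_add:
  assumes nonneg: "\<And>q x. q \<in> Q \<Longrightarrow> 0 \<le> q x"
    and "dominated_by Q p" and "dominated_by Q p'"
  shows "dominated_by Q (\<lambda>x. p x + p' x)"
proof -
  from assms(2) obtain F B where F: "finite F" "F \<subseteq> Q" "0 \<le> B" "\<And>x. p x \<le> B * (\<Sum>q\<in>F. q x)"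
    unfolding dominated_by_def by blast
  from assms(3) obtain F' B' where F': "finite F'" "F' \<subseteq> Q" "0 \<le> B'"
    "\<And>x. p' x \<le> B' * (\<Sum>q\<in>F'. q x)"
    unfolding dominated_by_def by blast
  have "p x + p' x \<le> (B + B') * (\<Sum>q\<in>F \<union> F'. q x)" for x
  proof -
    have "(\<Sum>q\<in>F. q x) \<le> (\<Sum>q\<in>F \<union> F'. q x)" "(\<Sum>q\<in>F'. q x) \<le> (\<Sum>q\<in>F \<union> F'. q x)"
      using F F' nonneg by (auto intro!: sum_mono2)
    then have "B * (\<Sum>q\<in>F. q x) \<le> B * (\<Sum>q\<in>F \<union> F'. q x)"
      "B' * (\<Sum>q\<in>F'. q x) \<le> B' * (\<Sum>q\<in>F \<union> F'. q x)"
      using F(3) F'(3) by (auto intro: mult_left_mono)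
    with F(4)[of x] F'(4)[of x] show ?thesis by (simp add: distrib_right)
  qed
  with F F' show ?thesis
    unfolding dominated_by_def by (intro exI[of _ "F \<union> F'"] exI[of _ "B + B'"]) auto
qed

lemma openin_seminorm_ball:
  assumes "p \<in> P" "x \<in> M" "0 < e"
  shows "openin (seminorm_topology M P) {y \<in> M. p (y - x) < e}"
  unfolding seminorm_topology_def using assms by (intro topology_generated_by_Basis) blast

text \<open>A ball of $p$ contains around each of its points a finite intersection of balls for the seminorms
that dominate $p$.\<close>

lemma seminorm_topology_le:
  fixes M :: "'b::real_vector set"
  assumes "Q \<noteq> {}" and zero: "\<And>q. q \<in> Q \<Longrightarrow> q 0 = 0"
    and dom: "\<And>p. p \<in> P \<Longrightarrow> dominated_by Q p"
    and subadd: "\<And>p x y. p \<in> P \<Longrightarrow> p (x + y) \<le> p x + p y"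
    and U: "openin (seminorm_topology M P) U"
  shows "openin (seminorm_topology M Q) U"
proof -
  have top: "topspace (seminorm_topology M Q) = M"
    using assms(1) zero by (rule topspace_seminorm_topology)
  have ball: "openin (seminorm_topology M Q) {y \<in> M. p (y - x) < e}"
    if p: "p \<in> P" and "x \<in> M" "0 < e" for p x and e :: real
  proof (subst openin_subopen, intro ballI)
    fix y assume y: "y \<in> {y \<in> M. p (y - x) < e}"
    from dom[OF p] obtain F B where F: "finite F" "F \<subseteq> Q" "0 \<le> B"
      and le: "\<And>z. p z \<le> B * (\<Sum>q\<in>F. q z)"
      unfolding dominated_by_def by blast
    \<comment> \<open>The \<open>+ 1\<close> keeps the denominator positive when \<open>B = 0\<close> or \<open>F\<close> is empty.\<close>
    define d where "d = (e - p (y - x)) / (B * card F + 1)"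
    have pos: "0 < B * card F + 1"
      using F(3) by (simp add: add_nonneg_pos)
    have d: "0 < d" using y pos by (simp add: d_def)
    define V where "V = (\<Inter>q\<in>F. {z \<in> M. q (z - y) < d}) \<inter> M"
    have "openin (seminorm_topology M Q) ((\<Inter>q\<in>F. {z \<in> M. q (z - y) < d}) \<inter> topspace (seminorm_topology M Q))"
      using F(1,2) y d by (intro openin_INT openin_seminorm_ball) auto
    then have "openin (seminorm_topology M Q) V"
      by (simp only: V_def top)
    moreover have "q (y - y) < d" if "q \<in> F" for q
      using zero[OF subsetD[OF F(2) that]] d by simp
    then have "y \<in> V"
      using y by (simp add: V_def)
    moreover have "V \<subseteq> {y \<in> M. p (y - x) < e}"
    proof
      fix z assume z: "z \<in> V"
      have "(\<Sum>q\<in>F. q (z - y)) \<le> (\<Sum>q\<in>F. d)"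
        using z by (intro sum_mono) (auto simp: V_def less_imp_le)
      then have "B * (\<Sum>q\<in>F. q (z - y)) \<le> B * card F * d"
        using mult_left_mono[OF _ F(3)] by (simp add: mult.assoc)
      also have "\<dots> < (B * card F + 1) * d"
        using d by (simp add: distrib_right)
      also have "\<dots> = e - p (y - x)"
        using pos by (simp add: d_def)
      finally have "p (z - y) < e - p (y - x)"
        using le[of "z - y"] by linarith
      moreover have "p (z - x) \<le> p (z - y) + p (y - x)"
        using subadd[OF p, of "z - y" "y - x"] by simp
      ultimately show "z \<in> {y \<in> M. p (y - x) < e}"
        using z by (auto simp: V_def)
    qed
    ultimately show "\<exists>T. openin (seminorm_topology M Q) T \<and> y \<in> T \<and> T \<subseteq> {y \<in> M. p (y - x) < e}"
      by blast
  qed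
  show ?thesis
  proof (rule generate_topology_on_coarsest[OF istopology_openin])
    show "generate_topology_on {{y \<in> M. p (y - x) < e} |p x e. p \<in> P \<and> x \<in> M \<and> 0 < e} U"
      using U unfolding seminorm_topology_def openin_topology_generated_by_iff .
    show "openin (seminorm_topology M Q) S"
      if "S \<in> {{y \<in> M. p (y - x) < e} |p x e. p \<in> P \<and> x \<in> M \<and> 0 < e}" for S
      using that ball by blast
  qed
qed

section \<open>The Arens product\<close>

lemma dual_mult_dual_mult: "dual_mult (dual_mult f a) b = dual_mult f (a * b)"
  by (rule cdual_eqI) (simp add: dual_mult_apply mult.assoc)

lemma bidual_act_dual_mult: "dual_mult (bidual_act z f) a = bidual_act z (dual_mult f a)"
  by (rule cdual_eqI) (simp add: dual_mult_apply bidual_act_apply dual_mult_dual_mult)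

lemma bidual_mult_assoc: "(x \<bullet>\<^sub>B y) \<bullet>\<^sub>B z = x \<bullet>\<^sub>B (y \<bullet>\<^sub>B z)"
proof (rule cdual_eqI)
  fix f
  have "bidual_act y (bidual_act z f) = bidual_act (y \<bullet>\<^sub>B z) f"
    by (rule cdual_eqI) (simp add: bidual_act_apply bidual_mult_apply bidual_act_dual_mult)
  then show "cdual_apply ((x \<bullet>\<^sub>B y) \<bullet>\<^sub>B z) f = cdual_apply (x \<bullet>\<^sub>B (y \<bullet>\<^sub>B z)) f"
    by (simp add: bidual_mult_apply)
qed

lemma bidual_act_linear_left:
  "bidual_act (x + y) f = bidual_act x f + bidual_act y f"
  "bidual_act (r *\<^sub>R x) f = r *\<^sub>R bidual_act x f"
  "bidual_act (c *\<^sub>C x) f = c *\<^sub>C bidual_act x f"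
  by (rule cdual_eqI,
      simp add: bidual_act_apply plus_cdual.rep_eq scaleR_cdual.rep_eq scaleC_cdual.rep_eq)+

lemma bidual_mult_linear:
  "(x + y) \<bullet>\<^sub>B z = x \<bullet>\<^sub>B z + y \<bullet>\<^sub>B z"
  "z \<bullet>\<^sub>B (x + y) = z \<bullet>\<^sub>B x + z \<bullet>\<^sub>B y"
  "(r *\<^sub>R x) \<bullet>\<^sub>B z = r *\<^sub>R (x \<bullet>\<^sub>B z)"
  "z \<bullet>\<^sub>B (r *\<^sub>R x) = r *\<^sub>R (z \<bullet>\<^sub>B x)"
  "(c *\<^sub>C x) \<bullet>\<^sub>B z = c *\<^sub>C (x \<bullet>\<^sub>B z)"
  "z \<bullet>\<^sub>B (c *\<^sub>C x) = c *\<^sub>C (z \<bullet>\<^sub>B x)"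
  by (rule cdual_eqI, simp add: bidual_mult_apply bidual_act_linear_left cdual_apply_linear
      cdual_apply_scaleC plus_cdual.rep_eq scaleR_cdual.rep_eq scaleC_cdual.rep_eq)+

lemma norm_bidual_mult: "norm (x \<bullet>\<^sub>B y) \<le> norm x * norm y"
proof (rule norm_cdual_bound)
  fix f
  have "norm (cdual_apply x (bidual_act y f)) \<le> norm x * norm (bidual_act y f)"
    by (rule norm_cdual_apply_le)
  also have "\<dots> \<le> norm x * (norm y * norm f)"
    by (intro mult_left_mono norm_bidual_act) simp
  finally show "norm (cdual_apply (x \<bullet>\<^sub>B y) f) \<le> norm x * norm y * norm f"
    by (simp add: bidual_mult_apply mult.assoc)
qed simp

lemma canon_linear:
  "canon (a + b) = canon a + canon b"
  "canon (c *\<^sub>C a) = c *\<^sub>C canon a"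
  by (rule cdual_eqI, simp add: canon.rep_eq cdual_apply_linear cdual_apply_scaleC
      plus_cdual.rep_eq scaleC_cdual.rep_eq)+

section \<open>Multiplication by a cube is controlled by Jordan products\<close>

lemma bidual_sandwich:
  "2 *\<^sub>R (u \<bullet>\<^sub>B x \<bullet>\<^sub>B u) =
    u \<bullet>\<^sub>B (x \<bullet>\<^sub>B u + u \<bullet>\<^sub>B x) + (x \<bullet>\<^sub>B u + u \<bullet>\<^sub>B x) \<bullet>\<^sub>B u - (x \<bullet>\<^sub>B (u \<bullet>\<^sub>B u) + (u \<bullet>\<^sub>B u) \<bullet>\<^sub>B x)"
  by (simp add: bidual_mult_linear bidual_mult_assoc scaleR_2)

text \<open>Multiplying $x u^2 + u^2 x$ by $u$ from the left leaves, besides $u^3 x$, the term $u x u^2$, which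
is a sandwich times $u$. So no one-sided product of $x$ survives on the right-hand side.\<close>

lemma cube_mult_identities:
  "(u \<bullet>\<^sub>B u \<bullet>\<^sub>B u) \<bullet>\<^sub>B x =
    u \<bullet>\<^sub>B (x \<bullet>\<^sub>B (u \<bullet>\<^sub>B u) + (u \<bullet>\<^sub>B u) \<bullet>\<^sub>B x) - (u \<bullet>\<^sub>B x \<bullet>\<^sub>B u) \<bullet>\<^sub>B u"
  "x \<bullet>\<^sub>B (u \<bullet>\<^sub>B u \<bullet>\<^sub>B u) =
    (x \<bullet>\<^sub>B (u \<bullet>\<^sub>B u) + (u \<bullet>\<^sub>B u) \<bullet>\<^sub>B x) \<bullet>\<^sub>B u - u \<bullet>\<^sub>B (u \<bullet>\<^sub>B x \<bullet>\<^sub>B u)"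
  by (simp_all add: bidual_mult_linear bidual_mult_assoc)

lemma two_jordan: "x \<bullet>\<^sub>B y + y \<bullet>\<^sub>B x = 2 *\<^sub>R (x \<circ>\<^sub>J y)"
  by (simp add: bidual_jordan_def)

lemma norm_sandwich_le:
  "norm (u \<bullet>\<^sub>B x \<bullet>\<^sub>B u) \<le> 2 * norm u * norm (x \<circ>\<^sub>J u) + norm (x \<circ>\<^sub>J (u \<bullet>\<^sub>B u))"
proof -
  define j where "j = x \<circ>\<^sub>J u"
  define k where "k = x \<circ>\<^sub>J (u \<bullet>\<^sub>B u)"
  have "u \<bullet>\<^sub>B x \<bullet>\<^sub>B u = (1/2) *\<^sub>R (2 *\<^sub>R (u \<bullet>\<^sub>B x \<bullet>\<^sub>B u))" by simp
  also have "\<dots> = u \<bullet>\<^sub>B j + j \<bullet>\<^sub>B u - k"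
    unfolding bidual_sandwich two_jordan[of x u] two_jordan[of x "u \<bullet>\<^sub>B u"] j_def k_def
    by (simp only: bidual_mult_linear scaleR_right_distrib scaleR_right_diff_distrib) simp
  finally have "norm (u \<bullet>\<^sub>B x \<bullet>\<^sub>B u) \<le> norm (u \<bullet>\<^sub>B j) + norm (j \<bullet>\<^sub>B u) + norm k"
    using norm_triangle_ineq4[of "u \<bullet>\<^sub>B j + j \<bullet>\<^sub>B u" k] norm_triangle_ineq[of "u \<bullet>\<^sub>B j" "j \<bullet>\<^sub>B u"]
    by simp
  moreover have "norm (j \<bullet>\<^sub>B u) \<le> norm u * norm j"
    using norm_bidual_mult[of j u] by (simp add: mult.commute)
  ultimately show ?thesis
    using norm_bidual_mult[of u j] by (simp add: j_def k_def)
qed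

lemma norm_cube_mult_le:
  defines "bound u x \<equiv> 2 * norm u * norm u * norm (x \<circ>\<^sub>J u) + 3 * norm u * norm (x \<circ>\<^sub>J (u \<bullet>\<^sub>B u))"
  shows "norm ((u \<bullet>\<^sub>B u \<bullet>\<^sub>B u) \<bullet>\<^sub>B x) \<le> bound u x"
    and "norm (x \<bullet>\<^sub>B (u \<bullet>\<^sub>B u \<bullet>\<^sub>B u)) \<le> bound u x"
proof -
  define k where "k = x \<circ>\<^sub>J (u \<bullet>\<^sub>B u)"
  define m where "m = u \<bullet>\<^sub>B x \<bullet>\<^sub>B u"
  have b: "norm u * norm (2 *\<^sub>R k) + norm u * norm m \<le> bound u x"
    using mult_left_mono[OF norm_sandwich_le[of u x] norm_ge_zero[of u]]
    by (simp add: bound_def k_def m_def algebra_simps)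
  have "norm ((u \<bullet>\<^sub>B u \<bullet>\<^sub>B u) \<bullet>\<^sub>B x) = norm (u \<bullet>\<^sub>B (2 *\<^sub>R k) - m \<bullet>\<^sub>B u)"
    by (simp only: cube_mult_identities two_jordan k_def m_def)
  also have "\<dots> \<le> norm u * norm (2 *\<^sub>R k) + norm u * norm m"
    using norm_triangle_ineq4[of "u \<bullet>\<^sub>B (2 *\<^sub>R k)" "m \<bullet>\<^sub>B u"]
      norm_bidual_mult[of u "2 *\<^sub>R k"] norm_bidual_mult[of m u] by (simp add: mult.commute)
  finally show "norm ((u \<bullet>\<^sub>B u \<bullet>\<^sub>B u) \<bullet>\<^sub>B x) \<le> bound u x" using b by simp
  have "norm (x \<bullet>\<^sub>B (u \<bullet>\<^sub>B u \<bullet>\<^sub>B u)) = norm ((2 *\<^sub>R k) \<bullet>\<^sub>B u - u \<bullet>\<^sub>B m)"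
    by (simp only: cube_mult_identities two_jordan k_def m_def)
  also have "\<dots> \<le> norm u * norm (2 *\<^sub>R k) + norm u * norm m"
    using norm_triangle_ineq4[of "(2 *\<^sub>R k) \<bullet>\<^sub>B u" "u \<bullet>\<^sub>B m"]
      norm_bidual_mult[of "2 *\<^sub>R k" u] norm_bidual_mult[of u m] by (simp add: mult.commute)
  finally show "norm (x \<bullet>\<^sub>B (u \<bullet>\<^sub>B u \<bullet>\<^sub>B u)) \<le> bound u x" using b by simp
qed

section \<open>The coefficients of binomial series\<close>

text \<open>The coefficient of $z^n$ in $(1-z)^{-s}$.\<close>

definition binomial_series_coeff :: "real \<Rightarrow> nat \<Rightarrow> real"
  where "binomial_series_coeff s n = pochhammer s n / fact n"

lemma binomial_series_coeff_nonneg: "0 \<le> s \<Longrightarrow> 0 \<le> binomial_series_coeff s n"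
  by (simp add: binomial_series_coeff_def pochhammer_prod prod_nonneg)

lemma binomial_series_coeff_1: "binomial_series_coeff 1 n = 1"
  by (simp add: binomial_series_coeff_def flip: pochhammer_fact)

text \<open>$(1-z)^{-s}(1-z)^{-t} = (1-z)^{-(s+t)}$, in the form of the Vandermonde identity for rising factorials.\<close>

lemma binomial_series_coeff_add:
  "(\<Sum>i\<le>n. binomial_series_coeff s i * binomial_series_coeff t (n - i)) = binomial_series_coeff (s + t) n"
proof -
  have "(\<Sum>i\<le>n. binomial_series_coeff s i * binomial_series_coeff t (n - i)) =
      (\<Sum>i\<le>n. of_nat (n choose i) * pochhammer s i * pochhammer t (n - i) / fact n)"
    by (intro sum.cong) (auto simp: binomial_series_coeff_def binomial_fact)
  then show ?thesis
    by (simp add: binomial_series_coeff_def pochhammer_binomial_sum flip: sum_divide_distrib)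
qed

lemma binomial_series_coeff_half: "binomial_series_coeff (1/2) n = ((2 * n) choose n) / 4 ^ n"
proof -
  have "real ((2 * n) choose n) = fact (2 * n) / (fact n * fact n)"
    by (simp add: binomial_fact)
  then show ?thesis
    by (simp add: fact_double binomial_series_coeff_def power_mult)
qed

text \<open>By induction: the ratio of consecutive coefficients is $(x - (1-s))/x$ with $x = n + 1$, and the weighted
inequality between arithmetic and geometric mean shows that it is at most $((x+1)/x)^{s-1}$.\<close>

lemma binomial_series_coeff_le:
  assumes "0 \<le> s" "s \<le> 1"
  shows "binomial_series_coeff s n \<le> real (n + 1) powr (s - 1)"
proof (induction n)
  case 0
  then show ?case by (simp add: binomial_series_coeff_def)
next
  case (Suc n)
  define x where "x = real (n + 1)"
  have x: "1 \<le> x" by (simp add: x_def)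
  have "binomial_series_coeff s (Suc n) = binomial_series_coeff s n * ((s + n) / x)"
    by (simp add: binomial_series_coeff_def pochhammer_Suc x_def)
  also have "\<dots> \<le> x powr (s - 1) * ((x - (1 - s)) / x)"
    using Suc assms x by (intro mult_mono) (auto simp: x_def add.commute)
  also have "\<dots> \<le> (x + 1) powr (s - 1)"
  proof -
    define P where "P = (x + 1) powr (1 - s)"
    define Q where "Q = x powr s"
    have P: "0 < P" using x by (simp add: P_def)
    have "P * Q \<le> (1 - s) * (x + 1) + s * x"
      unfolding P_def Q_def using assms x by (intro Youngs_inequality_0) auto
    then have "P * Q \<le> x + (1 - s)" by (simp add: algebra_simps)
    then have "(x - (1 - s)) * (P * Q) \<le> (x - (1 - s)) * (x + (1 - s))"
      using assms x by (intro mult_left_mono) auto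
    also have "\<dots> \<le> x * x"
      using zero_le_square[of "1 - s"] by (simp add: algebra_simps)
    finally have le: "(x - (1 - s)) * (P * Q) \<le> x * x" .
    have "x powr (s - 1) * ((x - (1 - s)) / x) = (x - (1 - s)) * (P * Q) / (x * x * P)"
      using x P by (simp add: Q_def powr_diff)
    also have "\<dots> \<le> x * x / (x * x * P)"
      using P by (intro divide_right_mono[OF le]) simp
    also have "\<dots> = (x + 1) powr (s - 1)"
      using x powr_minus_divide[of "x + 1" "1 - s"] by (simp add: P_def)
    finally show ?thesis .
  qed
  finally show ?case by (simp add: x_def add.commute)
qed

section \<open>Differences of powers of a nonexpansive linear map\<close>

text \<open>A row of Pascal's triangle increases up to its middle entry and decreases afterwards.\<close>

lemma sum_abs_diff_central_binomial:
  "(\<Sum>j<2 * n. \<bar>real ((2 * n) choose Suc j) - real ((2 * n) choose j)\<bar>) = 2 * real ((2 * n) choose n) - 2"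
proof -
  define f where "f j = real ((2 * n) choose j)" for j
  have "(\<Sum>j<2 * n. \<bar>f (Suc j) - f j\<bar>) = (\<Sum>j<n. \<bar>f (Suc j) - f j\<bar>) + (\<Sum>j=n..<2 * n. \<bar>f (Suc j) - f j\<bar>)"
    by (simp add: lessThan_atLeast0 sum.atLeastLessThan_concat)
  also have "(\<Sum>j<n. \<bar>f (Suc j) - f j\<bar>) = (\<Sum>j<n. f (Suc j) - f j)"
    by (intro sum.cong) (auto simp: f_def binomial_mono)
  also have "\<dots> = f n - f 0"
    by (rule sum_lessThan_telescope)
  also have "(\<Sum>j=n..<2 * n. \<bar>f (Suc j) - f j\<bar>) = (\<Sum>j=n..<2 * n. - f (Suc j) - (- f j))"
    by (intro sum.cong) (auto simp: f_def binomial_antimono)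
  also have "\<dots> = - f (2 * n) - (- f n)"
    by (rule sum_Suc_diff') simp
  finally show ?thesis by (simp add: f_def)
qed

lemma funpow_add_id_binomial:
  fixes S :: "'a::real_vector \<Rightarrow> 'a"
  assumes "linear S"
  shows "((\<lambda>x. x + S x) ^^ n) y = (\<Sum>j\<le>n. real (n choose j) *\<^sub>R (S ^^ j) y)"
proof (induction n)
  case 0
  then show ?case by simp
next
  case (Suc n)
  have "((\<lambda>x. x + S x) ^^ Suc n) y =
      (\<Sum>j\<le>n. real (n choose j) *\<^sub>R (S ^^ j) y) + (\<Sum>j\<le>n. real (n choose j) *\<^sub>R (S ^^ Suc j) y)"
    using assms by (simp add: Suc linear_sum linear_scale)
  also have "(\<Sum>j\<le>n. real (n choose j) *\<^sub>R (S ^^ j) y) = (\<Sum>j\<le>Suc n. real (n choose j) *\<^sub>R (S ^^ j) y)"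
    by simp
  also have "\<dots> = y + (\<Sum>j\<le>n. real (n choose Suc j) *\<^sub>R (S ^^ Suc j) y)"
    by (subst sum.atMost_Suc_shift) simp
  also have "\<dots> + (\<Sum>j\<le>n. real (n choose j) *\<^sub>R (S ^^ Suc j) y) =
      y + (\<Sum>j\<le>n. real (Suc n choose Suc j) *\<^sub>R (S ^^ Suc j) y)"
    by (simp add: sum.distrib[symmetric] scaleR_left_distrib algebra_simps)
  also have "\<dots> = (\<Sum>j\<le>Suc n. real (Suc n choose j) *\<^sub>R (S ^^ j) y)"
    by (simp only: sum.atMost_Suc_shift[of _ n]) simp
  finally show ?case .
qed

lemma norm_funpow_le:
  fixes S :: "'a::real_normed_vector \<Rightarrow> 'a"
  assumes "\<And>x. norm (S x) \<le> norm x"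
  shows "norm ((S ^^ n) x) \<le> norm x"
  by (induction n) (auto intro: order_trans[OF assms])

text \<open>Expanding $(1+S)^{2n}(S-1)$ in powers of $S$ and summing by parts makes the coefficients differences of
neighbouring binomial coefficients. Their cancellation gains a factor of order $n^{-1/2}$ over the trivial
bound $2 \cdot 4^n$.\<close>

lemma norm_binomial_difference_le:
  fixes S :: "'a::real_normed_vector \<Rightarrow> 'a"
  assumes lin: "linear S" and le: "\<And>x. norm (S x) \<le> norm x"
  shows "norm (((\<lambda>x. x + S x) ^^ (2 * n)) (S y - y)) \<le> 2 * ((2 * n) choose n) * norm y"
proof -
  define f where "f j = real ((2 * n) choose j)" for j
  have "((\<lambda>x. x + S x) ^^ (2 * n)) (S y - y) = (\<Sum>j\<le>2 * n. f j *\<^sub>R (S ^^ j) (S y - y))"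
    unfolding f_def by (rule funpow_add_id_binomial[OF lin])
  also have "\<dots> = (\<Sum>j\<le>2 * n. f j *\<^sub>R (S ^^ Suc j) y) - (\<Sum>j\<le>2 * n. f j *\<^sub>R (S ^^ j) y)"
  proof -
    have "(S ^^ j) (S y - y) = (S ^^ Suc j) y - (S ^^ j) y" for j
      by (induction j) (simp_all add: linear_diff[OF lin])
    then show ?thesis by (simp add: sum_subtractf scaleR_diff_right)
  qed
  also have "(\<Sum>j\<le>2 * n. f j *\<^sub>R (S ^^ Suc j) y) =
      (\<Sum>j<2 * n. f j *\<^sub>R (S ^^ Suc j) y) + (S ^^ Suc (2 * n)) y"
    by (simp add: f_def flip: lessThan_Suc_atMost)
  also have "(\<Sum>j\<le>2 * n. f j *\<^sub>R (S ^^ j) y) = y + (\<Sum>j<2 * n. f (Suc j) *\<^sub>R (S ^^ Suc j) y)"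
    by (subst sum.atMost_shift) (simp add: f_def)
  finally have "((\<lambda>x. x + S x) ^^ (2 * n)) (S y - y) =
      (S ^^ Suc (2 * n)) y - y - (\<Sum>j<2 * n. (f (Suc j) - f j) *\<^sub>R (S ^^ Suc j) y)"
    by (simp add: algebra_simps sum_subtractf del: funpow.simps)
  also have "norm \<dots> \<le> norm y + norm y + (\<Sum>j<2 * n. \<bar>f (Suc j) - f j\<bar> * norm y)"
  proof -
    have p: "norm ((S ^^ j) y) \<le> norm y" for j
      by (rule norm_funpow_le[OF le])
    have "norm (\<Sum>j<2 * n. (f (Suc j) - f j) *\<^sub>R (S ^^ Suc j) y) \<le> (\<Sum>j<2 * n. \<bar>f (Suc j) - f j\<bar> * norm y)"
      by (rule sum_norm_le) (use p in \<open>simp add: mult_left_mono del: funpow.simps\<close>)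
    with p[of "Suc (2 * n)"] show ?thesis
      using norm_triangle_ineq4[of "(S ^^ Suc (2 * n)) y" y]
        norm_triangle_ineq4[of "(S ^^ Suc (2 * n)) y - y" "\<Sum>j<2 * n. (f (Suc j) - f j) *\<^sub>R (S ^^ Suc j) y"]
      by linarith
  qed
  also have "\<dots> = 2 * ((2 * n) choose n) * norm y"
    unfolding f_def sum_distrib_right[symmetric] sum_abs_diff_central_binomial
    by (simp add: algebra_simps)
  finally show ?thesis .
qed

section \<open>Unitary dilation of a self-adjoint element\<close>

lemma adj_linear:
  "adj (r *\<^sub>R x) = r *\<^sub>R adj (x::'a::cstar_algebra)"
  "adj (- x) = - adj x"
  "adj (x - y) = adj x - adj y"
proof -
  show s: "adj (r *\<^sub>R x) = r *\<^sub>R adj x" for r and x :: 'a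
    using adj_scaleC[of "complex_of_real r" x] by (simp add: scaleC_of_real)
  show m: "adj (- x) = - adj x" for x :: 'a
    using s[of "-1" x] by simp
  show "adj (x - y) = adj x - adj y"
    using adj_add[of x "- y"] m[of y] by simp
qed

lemma norm_adj: "norm (adj x) = norm (x::'a::cstar_algebra)"
proof -
  have le: "norm x \<le> norm (adj x)" for x :: 'a
  proof (cases "x = 0")
    case False
    have "norm x * norm x \<le> norm (adj x) * norm x"
      using norm_mult_ineq[of "adj x" x] by (simp add: cstar_identity power2_eq_square)
    with False show ?thesis by simp
  qed simp
  from le[of x] le[of "adj x"] show ?thesis by (simp add: adj_adj)
qed

lemma continuous_on_adj: "continuous_on UNIV (adj :: 'a::cstar_algebra \<Rightarrow> 'a)"
  by (rule linear_continuous_on, rule bounded_linear_intro[of _ 1])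
    (simp_all add: adj_add adj_linear norm_adj)

lemma scaleC_i_i: "\<i> *\<^sub>C (\<i> *\<^sub>C x) = - x"
  using scaleC_of_real[of "-1" x] by (simp add: scaleC_scaleC)

lemma scaleC_minus_left: "(- c) *\<^sub>C x = - (c *\<^sub>C (x :: 'a::complex_normed_vector))"
  using scaleC_of_real[of "-1" "c *\<^sub>C x"] by (simp add: scaleC_scaleC)

lemma scaleC_minus_right: "c *\<^sub>C (- x) = - (c *\<^sub>C (x :: 'a::complex_normed_vector))"
  using scaleC_of_real[of "-1" x] scaleC_scaleC[of c "-1" x] by (simp add: scaleC_minus_left)

lemma scaleC_diff_right: "c *\<^sub>C (x - y) = c *\<^sub>C x - c *\<^sub>C (y :: 'a::complex_normed_vector)"
  using scaleC_add_right[of c "x - y" y] by (simp add: algebra_simps)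

lemma scaleC_scaleR: "c *\<^sub>C (r *\<^sub>R x) = r *\<^sub>R (c *\<^sub>C (x :: 'a::complex_normed_vector))"
  by (simp add: scaleC_scaleC mult.commute flip: scaleC_of_real)

text \<open>The element $v = 1 - \sqrt{1-a^2}$ lies in $A$ although $1$ need not. Since $(1-v)^2 = 1 - a^2$ amounts to
$v = \frac12(a^2 + v^2)$, it is a fixed point, and the self-adjoint elements of norm at most $1/2$ that
commute with $a$ form a closed set on which this map contracts.\<close>

lemma obtain_one_minus_sqrt:
  fixes a :: "'a::cstar_algebra"
  assumes sa: "adj a = a" and small: "norm a \<le> 1/2"
  obtains v where "adj v = v" "v * a = a * v" "2 *\<^sub>R v = a * a + v * v"
proof -
  define s where "s = {v. norm v \<le> 1/2 \<and> adj v = v \<and> v * a = a * v}"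
  define F where "F v = (1/2) *\<^sub>R (a * a + v * v)" for v
  have half: "norm (x * y) \<le> 1/4" if "norm x \<le> 1/2" "norm y \<le> 1/2" for x y :: 'a
  proof -
    have "norm x * norm y \<le> 1/2 * (1/2)" using that by (intro mult_mono) auto
    with norm_mult_ineq[of x y] show ?thesis by simp
  qed
  have "closed s"
    unfolding s_def using continuous_on_adj
    by (intro closed_Collect_conj closed_Collect_le closed_Collect_eq continuous_intros)
  then have "complete s" by (simp add: complete_eq_closed)
  moreover have "0 \<in> s" using adj_linear(1)[of 0 "0::'a"] by (simp add: s_def)
  moreover have "F ` s \<subseteq> s"
  proof (rule image_subsetI)
    fix v assume v: "v \<in> s"
    then have "norm (a * a) \<le> 1/4" "norm (v * v) \<le> 1/4"
      using half small by (auto simp: s_def)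
    then have "norm (F v) \<le> 1/2"
      using norm_triangle_ineq[of "a * a" "v * v"] by (simp add: F_def)
    moreover have "v * v * a = a * (v * v)"
      using v by (metis (mono_tags, lifting) s_def mem_Collect_eq mult.assoc)
    ultimately show "F v \<in> s"
      using v sa by (simp add: s_def F_def adj_linear adj_add adj_mult distrib_left distrib_right mult.assoc)
  qed
  moreover have "dist (F v) (F w) \<le> 1/2 * dist v w" if "v \<in> s" "w \<in> s" for v w
  proof -
    have "F v - F w = (1/2) *\<^sub>R (v * (v - w) + (v - w) * w)"
      by (simp add: F_def algebra_simps)
    moreover have "norm (v * (v - w)) \<le> 1/2 * norm (v - w)" "norm ((v - w) * w) \<le> norm (v - w) * (1/2)"
    proof -
      have "norm v \<le> 1/2" "norm w \<le> 1/2" using that by (auto simp: s_def)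
      then show "norm (v * (v - w)) \<le> 1/2 * norm (v - w)" "norm ((v - w) * w) \<le> norm (v - w) * (1/2)"
        using norm_mult_ineq[of v "v - w"] mult_right_mono[of "norm v" "1/2" "norm (v - w)"]
          norm_mult_ineq[of "v - w" w] mult_left_mono[of "norm w" "1/2" "norm (v - w)"]
        by (auto intro: order_trans)
    qed
    ultimately show ?thesis
      using norm_triangle_ineq[of "v * (v - w)" "(v - w) * w"] by (simp add: dist_norm)
  qed
  ultimately have "\<exists>!v\<in>s. F v = v"
    by (intro Banach_fix[where c = "1/2"]) auto
  then obtain v where v: "v \<in> s" "F v = v" by blast
  have "2 *\<^sub>R v = 2 *\<^sub>R F v" by (simp add: v)
  also have "\<dots> = a * a + v * v" by (simp add: F_def)
  finally show thesis using v by (intro that) (auto simp: s_def)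
qed

text \<open>The decay rate of $(1-a^2)^n a$ as a left multiplier. Writing $1 - a^2 = w^2$ with $w$ self-adjoint, the
formal unitaries $w \pm ia$ act as isometries $U$ and $V$ on $A$, and the estimate for nonexpansive maps
applies to $S = U^2$.\<close>

lemma norm_complement_power_mult_le:
  fixes a y :: "'a::cstar_algebra"
  assumes sa: "adj a = a" and small: "norm a \<le> 1/2"
  shows "norm (((\<lambda>x. x - a * a * x) ^^ n) (a * y)) \<le> ((2 * n) choose n) / 4 ^ n * norm y"
proof -
  obtain v where v: "adj v = v" and va: "v * a = a * v" and vv: "2 *\<^sub>R v = a * a + v * v"
    using obtain_one_minus_sqrt[OF sa small] by blast
  define U where "U x = x - v * x + \<i> *\<^sub>C (a * x)" for x
  define V where "V x = x - v * x - \<i> *\<^sub>C (a * x)" for x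
  define S where "S x = U (U x)" for x
  have va': "v * (a * x) = a * (v * x)" for x
    by (metis va mult.assoc)
  have vv': "v * (v * x) = 2 *\<^sub>R (v * x) - a * (a * x)" for x
  proof -
    have "v * v = 2 *\<^sub>R v - a * a" using vv by simp
    then show ?thesis by (metis mult.assoc left_diff_distrib mult_scaleR_left)
  qed
  have linU: "linear U" and linV: "linear V"
    by (rule linearI; simp add: U_def V_def algebra_simps scaleC_add_right scaleC_scaleR)+
  have VU: "V (U x) = x" and UV: "U (V x) = x" for x
    by (simp_all add: U_def V_def distrib_left right_diff_distrib scaleC_diff_right scaleC_add_right
        mult_scaleC_right scaleC_i_i va' vv' scaleR_2)
  \<comment> \<open>\<open>V\<close> is the adjoint of \<open>U\<close>; as it is also its inverse, the C*-identity makes both isometric.\<close>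
  have adjU: "adj (U x) * z = adj x * V z" for x z
    by (simp add: U_def V_def adj_add adj_linear adj_mult adj_scaleC v sa distrib_right distrib_left
        left_diff_distrib right_diff_distrib mult_scaleC_left mult_scaleC_right mult.assoc scaleC_minus_left)
  have normU: "norm (U x) = norm x" for x
    using cstar_identity[of "U x"] cstar_identity[of x] by (simp add: adjU VU)
  have normV: "norm (V x) = norm x" for x
    using normU[of "V x"] by (simp add: UV)
  have linS: "linear S" unfolding S_def using linear_compose[OF linU linU] by (simp add: o_def)
  have four: "4 *\<^sub>R x = x + x + x + x" for x :: 'a
    using scaleR_left_distrib[of 2 2 x] by (simp add: scaleR_2 add.assoc)
  have T: "4 *\<^sub>R (x - a * a * x) = U (U x + V x) + V (U x + V x)" for x
    by (simp add: U_def V_def distrib_left right_diff_distrib scaleR_diff_right va' vv' mult.assoc)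
      (simp add: scaleR_2 four)
  define T where "T x = x - a * a * x" for x
  define G where "G x = U x + V x" for x
  define R where "R x = x + S x" for x
  have Tn: "4 ^ k *\<^sub>R (T ^^ k) x = (G ^^ (2 * k)) x" for k x
  proof (induction k)
    case (Suc k)
    have "4 ^ Suc k *\<^sub>R (T ^^ Suc k) x = 4 *\<^sub>R T (4 ^ k *\<^sub>R (T ^^ k) x)"
      by (simp add: T_def scaleR_diff_right)
    also have "\<dots> = G (G ((G ^^ (2 * k)) x))"
      unfolding Suc by (simp add: T_def G_def T)
    finally show ?case by simp
  qed simp
  \<comment> \<open>\<open>U + V = V (1 + U\<^sup>2)\<close> replaces the two isometries by powers of \<open>S\<close> alone.\<close>
  have RV: "R (V x) = V (R x)" and GV: "G x = V (R x)" for x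
    by (simp_all add: R_def G_def S_def VU UV linear_add[OF linV])
  have RVk: "R ((V ^^ k) x) = (V ^^ k) (R x)" and VRk: "(R ^^ k) (V x) = V ((R ^^ k) x)" for k x
    by (induction k) (simp_all add: RV)
  have "(G ^^ k) x = (V ^^ k) ((R ^^ k) x)" for k x
    by (induction k) (simp_all add: GV RVk)
  moreover have "norm ((V ^^ k) x) = norm x" for k x
    by (induction k) (simp_all add: normV)
  ultimately have norm_G: "norm ((G ^^ k) x) = norm ((R ^^ k) x)" for k x
    by simp
  \<comment> \<open>Chosen such that \<open>2 \<i> a y' = a y\<close>; this is also where the factor \<open>1/2\<close> is gained.\<close>
  define y' where "y' = - (\<i> *\<^sub>C ((1/2) *\<^sub>R y))"
  have "a * y = U y' - V y'"
  proof -
    have "U y' - V y' = 2 *\<^sub>R (\<i> *\<^sub>C (a * y'))"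
      by (simp add: U_def V_def scaleR_2)
    then show ?thesis
      by (simp add: y'_def mult_scaleC_right scaleC_minus_right scaleC_i_i scaleC_scaleR)
  qed
  also have "\<dots> = V (S y' - y')"
    by (simp add: S_def linear_diff[OF linV] VU)
  finally have ay: "a * y = V (S y' - y')" .
  have "4 ^ n * norm ((T ^^ n) (a * y)) = norm (4 ^ n *\<^sub>R (T ^^ n) (a * y))"
    by simp
  also have "\<dots> = norm ((R ^^ (2 * n)) (S y' - y'))"
    by (simp only: Tn norm_G ay VRk normV)
  also have "\<dots> \<le> 2 * ((2 * n) choose n) * norm y'"
    unfolding R_def by (rule norm_binomial_difference_le[OF linS]) (simp add: S_def normU)
  also have "norm y' = norm y / 2"
    by (simp add: y'_def norm_scaleC)
  finally show ?thesis
    by (simp add: T_def field_simps)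
qed

section \<open>Cube roots of small self-adjoint elements\<close>

text \<open>The norm of an element $z$ is recovered from its action as a left multiplier on $z^*$.\<close>

lemma norm_complement_power_le:
  fixes a :: "'a::cstar_algebra"
  assumes sa: "adj a = a" and small: "norm a \<le> 1/2"
  shows "norm (((\<lambda>x. x - a * a * x) ^^ n) a) \<le> real (n + 1) powr (- 1/2)"
proof -
  define z where "z = ((\<lambda>x. x - a * a * x) ^^ n) a"
  define r where "r = ((2 * n) choose n) / (4 ^ n :: real)"
  have mult: "((\<lambda>x. x - a * a * x) ^^ n) a * y = ((\<lambda>x. x - a * a * x) ^^ n) (a * y)" for y
    by (induction n) (simp_all add: left_diff_distrib mult.assoc)
  have "norm z * norm z = norm (z * adj z)"
    using cstar_identity[of "adj z"] by (simp add: adj_adj norm_adj power2_eq_square)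
  also have "\<dots> \<le> r * norm z"
    using norm_complement_power_mult_le[OF sa small, of n "adj z"]
    by (simp add: z_def mult r_def norm_adj)
  finally have "norm z \<le> r"
    using mult_right_le_imp_le[of "norm z" "norm z" r] by (cases "z = 0") (auto simp: r_def)
  also have "r = binomial_series_coeff (1/2) n"
    by (simp add: r_def binomial_series_coeff_half)
  also have "\<dots> \<le> real (n + 1) powr (- 1/2)"
    using binomial_series_coeff_le[of "1/2" n] by simp
  finally show ?thesis by (simp add: z_def)
qed

lemma summable_norm_Cauchy_product:
  fixes f g :: "nat \<Rightarrow> 'a::{real_normed_algebra,banach}"
  assumes "summable (\<lambda>k. norm (f k))" "summable (\<lambda>k. norm (g k))"
  shows "summable (\<lambda>k. norm (\<Sum>i\<le>k. f i * g (k - i)))"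
proof (rule summable_comparison_test')
  show "summable (\<lambda>k. \<Sum>i\<le>k. norm (f i) * norm (g (k - i)))"
    using assms by (intro summable_Cauchy_product) auto
  show "norm (norm (\<Sum>i\<le>k. f i * g (k - i))) \<le> (\<Sum>i\<le>k. norm (f i) * norm (g (k - i)))"
    if "0 \<le> k" for k
    by (simp add: sum_norm_le norm_mult_ineq)
qed

text \<open>With $T$ the multiplication by $1 - a^2$, the cube root is $b = \sum_k c_k T^k a$, where $c_k$ are the coefficients of
$(1-t)^{-1/3}$. The convolution cube of $c$ is constantly $1$, so
$b^3 = \sum_k T^k a^3 = \sum_k T^k (a - Ta)$ telescopes to $a$.\<close>

lemma small_self_adjoint_is_cube:
  fixes a :: "'a::cstar_algebra"
  assumes sa: "adj a = a" and small: "norm a \<le> 1/2"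
  obtains b where "a = b * b * b"
proof -
  define T where "T x = x - a * a * x" for x
  define c where "c = binomial_series_coeff"
  define P where "P k = c (1/3) k *\<^sub>R (T ^^ k) a" for k
  have linT: "linear (T ^^ k)" for k
  proof (induction k)
    case 0
    then show ?case by (simp add: linear_iff)
  next
    case (Suc k)
    have "linear T" by (rule linearI) (simp_all add: T_def algebra_simps)
    with Suc show ?case using linear_compose[of "T ^^ k" T] by (simp add: o_def)
  qed
  have norm_T: "norm ((T ^^ k) a) \<le> real (k + 1) powr (- 1/2)" for k
    unfolding T_def by (rule norm_complement_power_le[OF sa small])
  have T_left: "(T ^^ k) x * y = (T ^^ k) (x * y)" for k x y
    by (induction k) (simp_all add: T_def left_diff_distrib mult.assoc)
  have T_a: "x * (T ^^ k) a = (T ^^ k) (x * a)" if "x * (a * a) = a * a * x" for x k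
  proof (induction k)
    case (Suc k)
    have "x * T ((T ^^ k) a) = T (x * (T ^^ k) a)"
      using that by (simp add: T_def right_diff_distrib) (metis mult.assoc)
    with Suc show ?case by simp
  qed simp
  have T_T: "(T ^^ i) x * (T ^^ j) a = (T ^^ (i + j)) (x * a)" if "x * (a * a) = a * a * x" for x i j
    by (simp add: T_left T_a[OF that] funpow_add)
  \<comment> \<open>\<open>-7/6 = (1/3 - 1) - 1/2\<close>, just below the threshold \<open>-1\<close> of summability.\<close>
  have "norm (P k) \<le> real (k + 1) powr (- 7/6)" for k
  proof -
    have "norm (P k) = c (1/3) k * norm ((T ^^ k) a)"
      using binomial_series_coeff_nonneg[of "1/3" k] by (simp add: P_def c_def)
    also have "\<dots> \<le> real (k + 1) powr (1/3 - 1) * real (k + 1) powr (- 1/2)"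
      unfolding c_def using binomial_series_coeff_nonneg[of "1/3" k]
      by (intro mult_mono binomial_series_coeff_le norm_T) auto
    also have "\<dots> = real (k + 1) powr (- 7/6)"
      by (simp flip: powr_add)
    finally show ?thesis .
  qed
  then have le: "norm (norm (P k)) \<le> real (k + 1) powr (- 7/6)" for k
    by (simp only: real_norm_def abs_norm_cancel)
  have "summable (\<lambda>k. real (k + 1) powr (- 7/6))"
    using summable_real_powr_iff[of "- 7/6"] summable_iff_shift[of "\<lambda>k. real k powr (- 7/6)" 1]
    by simp
  then have sP: "summable (\<lambda>k. norm (P k))"
    by (rule summable_comparison_test'[where N = 0]) (rule le)
  define b where "b = suminf P"
  have aa: "(T ^^ i) a * (T ^^ j) a = (T ^^ (i + j)) (a * a)"
    and aaa: "(T ^^ i) (a * a) * (T ^^ j) a = (T ^^ (i + j)) (a * a * a)" for i j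
    by (rule T_T, simp only: mult.assoc)+
  have P2: "(\<Sum>i\<le>k. P i * P (k - i)) = c (2/3) k *\<^sub>R (T ^^ k) (a * a)" for k
  proof -
    have "(\<Sum>i\<le>k. P i * P (k - i)) = (\<Sum>i\<le>k. (c (1/3) i * c (1/3) (k - i)) *\<^sub>R (T ^^ k) (a * a))"
    proof (rule sum.cong[OF refl])
      fix i assume "i \<in> {..k}"
      then show "P i * P (k - i) = (c (1/3) i * c (1/3) (k - i)) *\<^sub>R (T ^^ k) (a * a)"
        using aa[of i "k - i"] by (simp add: P_def)
    qed
    also have "\<dots> = c (2/3) k *\<^sub>R (T ^^ k) (a * a)"
      using binomial_series_coeff_add[where s = "1/3" and t = "1/3" and n = k]
      by (simp add: c_def flip: scaleR_sum_left)
    finally show ?thesis .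
  qed
  have P3: "(\<Sum>i\<le>k. (c (2/3) i *\<^sub>R (T ^^ i) (a * a)) * P (k - i)) = (T ^^ k) a - (T ^^ Suc k) a" for k
  proof -
    have "(\<Sum>i\<le>k. (c (2/3) i *\<^sub>R (T ^^ i) (a * a)) * P (k - i)) =
        (\<Sum>i\<le>k. (c (2/3) i * c (1/3) (k - i)) *\<^sub>R (T ^^ k) (a * a * a))"
    proof (rule sum.cong[OF refl])
      fix i assume "i \<in> {..k}"
      then show "(c (2/3) i *\<^sub>R (T ^^ i) (a * a)) * P (k - i) =
          (c (2/3) i * c (1/3) (k - i)) *\<^sub>R (T ^^ k) (a * a * a)"
        using aaa[of i "k - i"] by (simp add: P_def)
    qed
    also have "\<dots> = (T ^^ k) (a * a * a)"
      using binomial_series_coeff_add[where s = "2/3" and t = "1/3" and n = k]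
      by (simp add: c_def binomial_series_coeff_1 flip: scaleR_sum_left)
    also have "a * a * a = a - T a"
      by (simp add: T_def)
    also have "(T ^^ k) (a - T a) = (T ^^ k) a - (T ^^ Suc k) a"
      by (simp only: linear_diff[OF linT] funpow_Suc_right o_apply)
    finally show ?thesis .
  qed
  have b2: "(\<lambda>k. c (2/3) k *\<^sub>R (T ^^ k) (a * a)) sums (b * b)"
    using Cauchy_product_sums[OF sP sP] by (simp add: P2 b_def)
  have "summable (\<lambda>k. norm (c (2/3) k *\<^sub>R (T ^^ k) (a * a)))"
    using summable_norm_Cauchy_product[OF sP sP] by (simp only: P2)
  from Cauchy_product_sums[OF this sP] have "(\<lambda>k. (T ^^ k) a - (T ^^ Suc k) a) sums (b * b * b)"
    by (simp only: P3 b_def[symmetric] sums_unique[OF b2, symmetric])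
  moreover have "(\<lambda>k. (T ^^ k) a) \<longlonglongrightarrow> 0"
  proof (rule Lim_null_comparison)
    show "\<forall>\<^sub>F k in sequentially. norm ((T ^^ k) a) \<le> real (k + 1) powr (- 1/2)"
      using norm_T by simp
    show "(\<lambda>k. real (k + 1) powr (- 1/2)) \<longlonglongrightarrow> 0"
      by (rule tendsto_neg_powr)
        (simp, rule filterlim_compose[OF filterlim_real_sequentially], simp add: filterlim_Suc)
  qed
  from telescope_sums'[OF this] have "(\<lambda>k. (T ^^ k) a - (T ^^ Suc k) a) sums a"
    by simp
  ultimately have "a = b * b * b"
    by (rule sums_unique2[rotated])
  then show thesis by (rule that)
qed

lemma self_adjoint_is_multiple_of_cube:
  fixes a :: "'a::cstar_algebra"
  assumes "adj a = a"
  obtains r b where "0 \<le> r" "a = r *\<^sub>R (b * b * b)"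
proof -
  define r where "r = 2 * norm a + 1"
  have r: "0 < r" by (simp add: r_def add_nonneg_pos)
  have "adj ((1/r) *\<^sub>R a) = (1/r) *\<^sub>R a"
    using assms by (simp add: adj_linear)
  moreover have "norm ((1/r) *\<^sub>R a) \<le> 1/2"
    using r by (simp add: r_def field_simps)
  ultimately obtain b where "(1/r) *\<^sub>R a = b * b * b"
    using small_self_adjoint_is_cube by blast
  then have "a = r *\<^sub>R (b * b * b)"
    using r by (simp flip: \<open>(1/r) *\<^sub>R a = b * b * b\<close>)
  with r show thesis by (intro that[of r b]) auto
qed

text \<open>The real and imaginary parts of $a$ are self-adjoint.\<close>

lemma cubes_span:
  fixes a :: "'a::cstar_algebra"
  obtains r s b c where "0 \<le> r" "0 \<le> s" "a = r *\<^sub>R (b * b * b) + \<i> *\<^sub>C (s *\<^sub>R (c * c * c))"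
proof -
  define p where "p = (1/2) *\<^sub>R (a + adj a)"
  define d where "d = (1/2) *\<^sub>R (a - adj a)"
  define q where "q = - (\<i> *\<^sub>C d)"
  have p: "adj p = p"
    unfolding p_def adj_linear(1) adj_add adj_adj by (simp only: add.commute)
  have "adj d = (1/2) *\<^sub>R (adj a - a)"
    unfolding d_def adj_linear(1) adj_linear(3) adj_adj ..
  also have "\<dots> = - d"
    unfolding d_def by (simp only: scaleR_minus_right[symmetric] minus_diff_eq)
  finally have "adj d = - d" .
  then have q: "adj q = q"
    by (simp add: q_def adj_linear(2) adj_scaleC scaleC_minus_left scaleC_minus_right)
  have "p + \<i> *\<^sub>C q = p + d"
    by (simp add: q_def scaleC_minus_right scaleC_i_i)
  also have "\<dots> = (1/2) *\<^sub>R (2 *\<^sub>R a)"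
    unfolding p_def d_def scaleR_right_distrib[symmetric] by (simp add: scaleR_2)
  finally have a: "a = p + \<i> *\<^sub>C q" by simp
  obtain r b where "0 \<le> r" "p = r *\<^sub>R (b * b * b)"
    using self_adjoint_is_multiple_of_cube[OF p] by blast
  moreover obtain s c where "0 \<le> s" "q = s *\<^sub>R (c * c * c)"
    using self_adjoint_is_multiple_of_cube[OF q] by blast
  ultimately show thesis
    using a by (intro that[of r s b c]) simp_all
qed

section \<open>The two strict topologies\<close>

text \<open>For a cube $b^3$ the seminorms of $b$ and $b^2$ are enough, and the cubes span $A$.\<close>

lemma mult_canon_dominated_by_jordan:
  fixes a :: "'a::cstar_algebra"
  defines "Q \<equiv> range (\<lambda>b x. norm (x \<circ>\<^sub>J canon (b::'a)))"
  shows "dominated_by Q (\<lambda>x. norm (canon a \<bullet>\<^sub>B x))"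
    and "dominated_by Q (\<lambda>x. norm (x \<bullet>\<^sub>B canon a))"
proof -
  have nonneg: "0 \<le> q x" if "q \<in> Q" for q x
    using that by (auto simp: Q_def)
  have member: "dominated_by Q (\<lambda>x. norm (x \<circ>\<^sub>J canon b))" for b
    by (rule dominated_by_member) (simp add: Q_def)
  have bound: "dominated_by Q (\<lambda>x. 2 * norm (canon b) * norm (canon b) * norm (x \<circ>\<^sub>J canon b)
      + 3 * norm (canon b) * norm (x \<circ>\<^sub>J (canon b \<bullet>\<^sub>B canon b)))" for b
    unfolding canon_mult[symmetric]
    by (rule dominated_by_add[OF _ dominated_by_cmult[OF member] dominated_by_cmult[OF member]])
      (simp_all add: nonneg)
  have cube: "dominated_by Q (\<lambda>x. norm (canon (b * b * b) \<bullet>\<^sub>B x))"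
    "dominated_by Q (\<lambda>x. norm (x \<bullet>\<^sub>B canon (b * b * b)))" for b
    unfolding canon_mult by (rule dominated_by_mono[OF bound norm_cube_mult_le(1)])
      (rule dominated_by_mono[OF bound norm_cube_mult_le(2)])
  obtain r s b c where rs: "0 \<le> r" "0 \<le> s" and a: "a = r *\<^sub>R (b * b * b) + \<i> *\<^sub>C (s *\<^sub>R (c * c * c))"
    using cubes_span by blast
  have can: "canon a = complex_of_real r *\<^sub>C canon (b * b * b) + (\<i> * complex_of_real s) *\<^sub>C canon (c * c * c)"
    unfolding a by (simp only: canon_linear scaleC_scaleC[symmetric] scaleC_of_real[symmetric])
  show "dominated_by Q (\<lambda>x. norm (canon a \<bullet>\<^sub>B x))"
  proof (rule dominated_by_mono)
    show "dominated_by Q (\<lambda>x. r * norm (canon (b * b * b) \<bullet>\<^sub>B x) + s * norm (canon (c * c * c) \<bullet>\<^sub>B x))"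
      by (rule dominated_by_add[OF _ dominated_by_cmult[OF cube(1)] dominated_by_cmult[OF cube(1)]])
        (simp_all add: nonneg rs)
    show "norm (canon a \<bullet>\<^sub>B x) \<le> r * norm (canon (b * b * b) \<bullet>\<^sub>B x) + s * norm (canon (c * c * c) \<bullet>\<^sub>B x)" for x
      unfolding can bidual_mult_linear using rs
      by (intro order_trans[OF norm_triangle_ineq]) (simp add: norm_scaleC norm_mult)
  qed
  show "dominated_by Q (\<lambda>x. norm (x \<bullet>\<^sub>B canon a))"
  proof (rule dominated_by_mono)
    show "dominated_by Q (\<lambda>x. r * norm (x \<bullet>\<^sub>B canon (b * b * b)) + s * norm (x \<bullet>\<^sub>B canon (c * c * c)))"
      by (rule dominated_by_add[OF _ dominated_by_cmult[OF cube(2)] dominated_by_cmult[OF cube(2)]])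
        (simp_all add: nonneg rs)
    show "norm (x \<bullet>\<^sub>B canon a) \<le> r * norm (x \<bullet>\<^sub>B canon (b * b * b)) + s * norm (x \<bullet>\<^sub>B canon (c * c * c))" for x
      unfolding can bidual_mult_linear using rs
      by (intro order_trans[OF norm_triangle_ineq]) (simp add: norm_scaleC norm_mult)
  qed
qed

theorem lemma2p3:
  shows "(cstar_strict_topology :: 'a::cstar_algebra bidual topology) = j_strict_topology"
proof -
  define L where "L = (\<lambda>a (x :: 'a bidual). norm (canon a \<bullet>\<^sub>B x))"
  define R where "R = (\<lambda>a (x :: 'a bidual). norm (x \<bullet>\<^sub>B canon a))"
  define J where "J = (\<lambda>a (x :: 'a bidual). norm (x \<circ>\<^sub>J canon a))"
  have mult_0: "u \<bullet>\<^sub>B 0 = 0" "0 \<bullet>\<^sub>B u = 0" for u :: "'a bidual"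
    using bidual_mult_linear(2)[of u 0 0] bidual_mult_linear(1)[of 0 0 u] by simp_all
  have LRJ_zero: "L a 0 = 0" "R a 0 = 0" "J a 0 = 0" for a
    by (simp_all add: L_def R_def J_def bidual_jordan_def mult_0)
  have subadd: "L a (x + y) \<le> L a x + L a y" "R a (x + y) \<le> R a x + R a y" "J a (x + y) \<le> J a x + J a y"
    for a x y
  proof -
    have "(x + y) \<circ>\<^sub>J canon a = x \<circ>\<^sub>J canon a + y \<circ>\<^sub>J canon a"
      by (simp add: bidual_jordan_def bidual_mult_linear flip: scaleR_right_distrib)
    then show "L a (x + y) \<le> L a x + L a y" "R a (x + y) \<le> R a x + R a y" "J a (x + y) \<le> J a x + J a y"
      by (simp_all add: L_def R_def J_def bidual_mult_linear norm_triangle_ineq)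
  qed
  have J_dom: "dominated_by (range L \<union> range R) (J a)" for a
  proof (rule dominated_by_mono)
    show "dominated_by (range L \<union> range R) (\<lambda>x. 1/2 * (R a x + L a x))"
      by (intro dominated_by_cmult dominated_by_add dominated_by_member) (auto simp: L_def R_def)
    show "J a x \<le> 1/2 * (R a x + L a x)" for x
      using norm_triangle_ineq[of "x \<bullet>\<^sub>B canon a" "canon a \<bullet>\<^sub>B x"]
      by (simp add: J_def L_def R_def bidual_jordan_def)
  qed
  have LR_dom: "dominated_by (range J) (L a)" "dominated_by (range J) (R a)" for a
    unfolding L_def R_def J_def by (rule mult_canon_dominated_by_jordan)+
  have "openin (seminorm_topology multipliers (range L \<union> range R)) U \<longleftrightarrow>
      openin (seminorm_topology multipliers (range J)) U" for U
  proof
    assume "openin (seminorm_topology multipliers (range L \<union> range R)) U"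
    then show "openin (seminorm_topology multipliers (range J)) U"
      by (rule seminorm_topology_le[rotated 4]) (auto simp: LRJ_zero LR_dom subadd)
  next
    assume "openin (seminorm_topology multipliers (range J)) U"
    then show "openin (seminorm_topology multipliers (range L \<union> range R)) U"
      by (rule seminorm_topology_le[rotated 4]) (auto simp: LRJ_zero J_dom subadd)
  qed
  then show ?thesis
    by (simp add: topology_eq cstar_strict_topology_def j_strict_topology_def L_def R_def J_def)
qed

end
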